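(* Let $X$ be a Hilbert space and let $f: X \to (-\infty, \infty]$ be a proper, lower semi-continuous, convex function with $S:=\arg\min_{x\in X} f(x) \ne \emptyset$. Let $\bar x \in S$ and $f_*:= f(\bar x)$. If there exist $r>0$, $\eta>0$ and a desingularizing function $\varphi\in \mathcal{K}(0, \eta)$ such that $$\varphi'(f(x) - f_* )\, d(0, \partial f(x)) \ge 1$$ for all $x \in B_r(\bar x)$ with $f_* < f(x) < f_* + \eta$, then $$d(x, S) \le 2 \varphi(f(x) - f_* )$$ for all $x \in B_r(\bar x)$ with $f_* \le f(x) < f_* + \eta$.
   Context: $X$ is a (real) Hilbert space. $B_r(\bar x)$ denotes the open ball of radius $r$ centered at $\bar x$. For a set $A\subset X$, $d(x,A):=\inf_{z\in A}\|x-z\|$, with $d(x,\emptyset)=+\infty$. $\partial f$ denotes the convex subdifferential of $f$. For $\eta\in(0,\infty]$, the class of desingularizing functions is $$\mathcal{K}(0, \eta) := \{\varphi \in C[0, \eta) \cap C^1(0, \eta): \varphi(0) =0,\ \varphi \text{ is concave},\ \varphi'(s)>0 \text{ for } s\in(0,\eta)\}.$$ *)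

theory Defs
  imports "HOL-Analysis.Analysis"
begin

definition proper_fun :: "('a \<Rightarrow> ereal) \<Rightarrow> bool" where
  "proper_fun f \<longleftrightarrow> (\<forall>x. f x \<noteq> -\<infinity>) \<and> (\<exists>x. f x \<noteq> \<infinity>)"

definition lower_semicontinuous :: "('a::topological_space \<Rightarrow> ereal) \<Rightarrow> bool" where
  "lower_semicontinuous f \<longleftrightarrow> (\<forall>x. f x \<le> Liminf (at x) f)"

(* The library's convex_on covers real-valued functions only. The right-hand side is used
   for functions that avoid -\<infinity>, so no sum \<infinity> + (-\<infinity>) occurs. *)
definition convex_fun :: "('a::real_vector \<Rightarrow> ereal) \<Rightarrow> bool" where
  "convex_fun f \<longleftrightarrow>
     (\<forall>x y t. 0 < t \<and> t < 1 \<longrightarrow>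
        f ((1 - t) *\<^sub>R x + t *\<^sub>R y) \<le> ereal (1 - t) * f x + ereal t * f y)"

definition argmin_set :: "('a \<Rightarrow> ereal) \<Rightarrow> 'a set" where
  "argmin_set f = {x. is_arg_min f (\<lambda>_. True) x}"

(* The dual space is identified with the Hilbert space itself through the inner product;
   the subdifferential is empty outside the effective domain. *)
definition subdifferential :: "('a::real_inner \<Rightarrow> ereal) \<Rightarrow> 'a \<Rightarrow> 'a set" where
  "subdifferential f x =
     {v. \<bar>f x\<bar> \<noteq> \<infinity> \<and> (\<forall>y. f x + ereal (v \<bullet> (y - x)) \<le> f y)}"

(* Extended-real valued because the library's infdist gives 0, not \<infinity>, for the empty set. *)
definition set_distance :: "'a::real_normed_vector \<Rightarrow> 'a set \<Rightarrow> ereal" where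
  "set_distance x A = (INF z\<in>A. ereal (norm (x - z)))"

lemma set_distance_empty [simp]: "set_distance x {} = \<infinity>"
  by (simp add: set_distance_def top_ereal_def)

(* The class K(0, \<eta>) for \<eta> in (0, \<infinity>]; members are total functions on the reals whose values
   outside [0, \<eta>) are irrelevant. *)
definition desingularizing :: "ereal \<Rightarrow> (real \<Rightarrow> real) set" where
  "desingularizing \<eta> =
     {\<phi>. continuous_on {s. 0 \<le> s \<and> ereal s < \<eta>} \<phi> \<and>
         \<phi> C1_differentiable_on {s. 0 < s \<and> ereal s < \<eta>} \<and>
         \<phi> 0 = 0 \<and>
         concave_on {s. 0 \<le> s \<and> ereal s < \<eta>} \<phi> \<and>
         (\<forall>s. 0 < s \<and> ereal s < \<eta> \<longrightarrow> 0 < deriv \<phi> s)}"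

end

theory Submission
  imports Defs
begin

text \<open>
  Let \<open>c\<close> be the minimum of \<open>f\<close>, fix \<open>x\<close>, and let \<open>D s\<close> be the distance from \<open>x\<close> to the sublevel
  set \<open>{f \<le> s}\<close>. Convexity of \<open>f\<close> makes \<open>D\<close> a convex, decreasing function of the level \<open>s \<ge> c\<close>, so
  at each level \<open>s\<close> between \<open>c\<close> and \<open>f x\<close> it has a supporting line, of slope \<open>-t\<close> say, and only
  \<open>t > 0\<close> is of interest. This \<open>t\<close> is a Lagrange multiplier: the projection \<open>p\<close> of \<open>x\<close> onto
  \<open>{f \<le> s}\<close> minimises \<open>\<parallel>x - y\<parallel> + t * f y\<close> over all \<open>y\<close>, and \<open>f p = s\<close>.
  Its optimality condition gives a subgradient of norm \<open>1 / t\<close> at \<open>p\<close>. Since projecting onto a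
  convex set that contains the minimiser \<open>xbar\<close> does not increase the distance to \<open>xbar\<close>, the point
  \<open>p\<close> stays in the ball. There the hypothesis says \<open>t \<le> \<phi>' (s - c)\<close>, that is,
  \<open>D s \<le> D s' + \<phi>' (s - c) * (s' - s)\<close> for \<open>s' \<ge> s\<close> (\<open>sublevel_distance_slope\<close>,
  \<open>sublevel_distance_step\<close>).

  The levels \<open>c + b n\<close> with \<open>b n = (f x - c) / 2 ^ n\<close> start with \<open>D = 0\<close>. A step down from \<open>b n\<close> to
  \<open>b (n + 1)\<close> is twice as long as the next one, so by the tangent inequality for the concave \<open>\<phi>\<close> it
  increases \<open>D\<close> by at most \<open>2 * (\<phi> (b (n + 1)) - \<phi> (b (n + 2)))\<close>. This is where the
  factor 2 arises, and the sum telescopes: \<open>D\<close> never exceeds \<open>2 * \<phi> (f x - c)\<close>.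

  It remains to let the level tend to \<open>c\<close>. Decreasing bounded closed convex sets in a Hilbert space
  have a common point (\<open>Inter_decreasing_closed_convex_nonempty\<close>), which replaces compactness. Applied
  to the sublevel sets intersected with a closed ball around \<open>x\<close>, this gives a minimiser within the
  same distance.
\<close>

section \<open>Extended-real convex functions and their sublevel sets\<close>

definition sublevel :: "('a \<Rightarrow> ereal) \<Rightarrow> real \<Rightarrow> 'a set" where
  "sublevel f s = {y. f y \<le> ereal s}"

lemma sublevel_mono: "s \<le> s' \<Longrightarrow> sublevel f s \<subseteq> sublevel f s'"
  unfolding sublevel_def using ereal_less_eq(3) order_trans by blast

lemma convex_fun_combination_le:
  assumes "convex_fun f" "f x \<le> ereal a" "f y \<le> ereal b" "0 \<le> t" "t \<le> 1"
  shows "f ((1 - t) *\<^sub>R x + t *\<^sub>R y) \<le> ereal ((1 - t) * a + t * b)"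
proof -
  consider "t = 0" | "t = 1" | "0 < t" "t < 1"
    using assms by linarith
  then show ?thesis
  proof cases
    case 3
    then have "f ((1 - t) *\<^sub>R x + t *\<^sub>R y) \<le> ereal (1 - t) * f x + ereal t * f y"
      using assms(1) unfolding convex_fun_def by blast
    also have "\<dots> \<le> ereal (1 - t) * ereal a + ereal t * ereal b"
      using 3 assms by (intro add_mono ereal_mult_left_mono) auto
    finally show ?thesis by simp
  qed (use assms in auto)
qed

lemma convex_sublevel:
  assumes "convex_fun f"
  shows "convex (sublevel f s)"
proof -
  have "(1 - t) *\<^sub>R x + t *\<^sub>R y \<in> sublevel f s"
    if "x \<in> sublevel f s" "y \<in> sublevel f s" "0 \<le> t" "t \<le> 1" for x y t
  proof -
    have "f ((1 - t) *\<^sub>R x + t *\<^sub>R y) \<le> ereal ((1 - t) * s + t * s)"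
      using that assms by (intro convex_fun_combination_le) (auto simp: sublevel_def)
    then show ?thesis by (simp add: sublevel_def algebra_simps)
  qed
  then show ?thesis unfolding convex_alt by blast
qed

lemma closed_sublevel:
  assumes "lower_semicontinuous f"
  shows "closed (sublevel f s)"
proof -
  have "open {y. ereal s < f y}"
  proof (subst open_subopen, safe)
    fix y assume y: "ereal s < f y"
    then have "ereal s < Liminf (at y) f"
      using assms unfolding lower_semicontinuous_def by (meson less_le_trans)
    then have "\<forall>\<^sub>F z in at y. ereal s < f z"
      by (rule less_LiminfD)
    then obtain T where "open T" "y \<in> T" "\<forall>z\<in>T. z \<noteq> y \<longrightarrow> ereal s < f z"
      unfolding eventually_at_topological by blast
    with y show "\<exists>T. open T \<and> y \<in> T \<and> T \<subseteq> {y. ereal s < f y}"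
      by (intro exI[of _ T]) auto
  qed
  moreover have "- sublevel f s = {y. ereal s < f y}"
    by (auto simp: sublevel_def)
  ultimately show ?thesis by (simp add: closed_def)
qed

section \<open>Closed convex sets in a Hilbert space\<close>

text \<open>
  Nearly norm-minimal points \<open>y n\<close> of the sets form a Cauchy sequence: the midpoint of two of them
  lies in the larger set, so its norm is bounded below by that set's distance to the origin, and the
  parallelogram law then forces the two points together because these distances converge.
\<close>
lemma Inter_decreasing_closed_convex_nonempty:
  fixes C :: "nat \<Rightarrow> 'a::{real_inner, complete_space} set"
  assumes closed: "\<And>n. closed (C n)" and convex: "\<And>n. convex (C n)"
    and nonempty: "\<And>n. C n \<noteq> {}" and dec: "decseq C" and bounded: "bounded (C 0)"
  shows "(\<Inter>n. C n) \<noteq> {}"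
proof -
  define d where "d n = infdist 0 (C n)" for n
  obtain B where B: "\<And>y. y \<in> C 0 \<Longrightarrow> norm y \<le> B"
    using bounded unfolding bounded_iff by blast
  have d_le: "d n \<le> norm y" if "y \<in> C n" for n y
    using infdist_le[OF that, of 0] by (simp add: d_def)
  have "incseq d"
    unfolding d_def incseq_def using infdist_mono[OF decseqD[OF dec] nonempty] by blast
  moreover have "d n \<le> B" for n
    using d_le B decseqD[OF dec, of 0 n] nonempty[of n]
    by (meson all_not_in_conv le0 order_trans subsetD)
  ultimately obtain L where L: "d \<longlonglongrightarrow> L" "\<And>n. d n \<le> L"
    using incseq_convergent by metis
  have "\<exists>y\<in>C n. norm y < d n + 1 / real (Suc n)" for n
  proof -
    have "(INF a\<in>C n. dist 0 a) < d n + 1 / real (Suc n)"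
      using nonempty[of n] by (simp add: d_def infdist_notempty)
    then have "\<exists>a\<in>C n. dist 0 a < d n + 1 / real (Suc n)"
      using nonempty[of n] by (subst (asm) cINF_less_iff) (auto intro: bdd_belowI[of _ 0])
    then show ?thesis by simp
  qed
  then obtain y where yC: "\<And>n. y n \<in> C n" and y: "\<And>n. norm (y n) < d n + 1 / real (Suc n)"
    by metis
  define e where "e n = 4 * (L + 1 / real (Suc n))\<^sup>2 - 4 * (d n)\<^sup>2" for n
  have "e \<longlonglongrightarrow> 4 * (L + 0)\<^sup>2 - 4 * L\<^sup>2"
    unfolding e_def using L(1) LIMSEQ_Suc[OF lim_1_over_n] by (intro tendsto_intros) auto
  then have e0: "e \<longlonglongrightarrow> 0" by simp
  have L0: "0 \<le> L"
    using L(2)[of 0] infdist_nonneg[of 0 "C 0"] by (simp add: d_def)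
  have gap: "(norm (y m - y n))\<^sup>2 \<le> e n" if "n \<le> m" for m n
  proof -
    have bnd: "(norm (y k))\<^sup>2 \<le> (L + 1 / real (Suc n))\<^sup>2" if "n \<le> k" for k
    proof (rule power_mono)
      have "1 / real (Suc k) \<le> 1 / real (Suc n)"
        using that by (simp add: frac_le)
      then show "norm (y k) \<le> L + 1 / real (Suc n)"
        using y[of k] L(2)[of k] by linarith
    qed simp
    have "y m \<in> C n" using yC decseqD[OF dec that] by blast
    then have "(1/2) *\<^sub>R y m + (1/2) *\<^sub>R y n \<in> C n"
      using yC[of n] convex[of n] by (intro convexD) auto
    then have "d n \<le> norm ((1/2) *\<^sub>R y m + (1/2) *\<^sub>R y n)"
      by (rule d_le)
    also have "\<dots> = norm (y m + y n) / 2"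
      by (simp flip: scaleR_right_distrib)
    finally have "(2 * d n)\<^sup>2 \<le> (norm (y m + y n))\<^sup>2"
      using infdist_nonneg[of 0 "C n"] by (intro power_mono) (auto simp: d_def)
    then have "4 * (d n)\<^sup>2 \<le> (norm (y m + y n))\<^sup>2"
      by (simp add: power_mult_distrib)
    moreover have "(norm (y m - y n))\<^sup>2 = 2 * (norm (y m))\<^sup>2 + 2 * (norm (y n))\<^sup>2 - (norm (y m + y n))\<^sup>2"
      by (simp add: power2_norm_eq_inner algebra_simps inner_commute)
    ultimately show ?thesis
      using bnd[OF that] bnd[of n] by (simp add: e_def)
  qed
  have "Cauchy y"
    unfolding Cauchy_altdef2
  proof (intro allI impI)
    fix \<epsilon> :: real assume "0 < \<epsilon>"
    then obtain N where N: "e N < \<epsilon>\<^sup>2"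
      using order_tendstoD(2)[OF e0, of "\<epsilon>\<^sup>2"] by (auto simp: eventually_sequentially)
    have "dist (y n) (y N) < \<epsilon>" if "n \<ge> N" for n
    proof -
      have "(norm (y n - y N))\<^sup>2 < \<epsilon>\<^sup>2" using gap[OF that] N by linarith
      then show ?thesis
        using \<open>0 < \<epsilon>\<close> by (auto simp: dist_norm intro: power2_less_imp_less)
    qed
    then show "\<exists>N. \<forall>n\<ge>N. dist (y n) (y N) < \<epsilon>" by blast
  qed
  then obtain z where z: "y \<longlonglongrightarrow> z"
    using Cauchy_convergent convergentD by blast
  have "z \<in> C n" for n
  proof (rule Lim_in_closed_set[OF closed _ _ z])
    show "\<forall>\<^sub>F k in sequentially. y k \<in> C n"
      using yC decseqD[OF dec] by (intro eventually_sequentiallyI[of n]) blast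
  qed simp
  then show ?thesis by blast
qed

text \<open>
  The points of \<open>S\<close> that are nearest to \<open>x\<close> up to an error \<open>1 / (n + 1)\<close> form decreasing bounded
  closed convex sets, whose common points are exactly the nearest points.
\<close>
lemma nearest_point_exists:
  fixes S :: "'a::{real_inner, complete_space} set"
  assumes "closed S" "convex S" "S \<noteq> {}"
  obtains p where "p \<in> S" "dist x p = infdist x S"
proof -
  define C where "C n = S \<inter> cball x (infdist x S + 1 / real (Suc n))" for n
  have "(\<Inter>n. C n) \<noteq> {}"
  proof (rule Inter_decreasing_closed_convex_nonempty)
    fix n
    have "(INF a\<in>S. dist x a) < infdist x S + 1 / real (Suc n)"
      using assms by (simp add: infdist_notempty)
    then obtain a where "a \<in> S" "dist x a < infdist x S + 1 / real (Suc n)"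
      using assms by (auto simp: cINF_less_iff)
    then show "C n \<noteq> {}" by (force simp: C_def)
  next
    show "decseq C"
    proof (rule decseq_SucI)
      fix n
      have "1 / real (Suc (Suc n)) \<le> 1 / real (Suc n)" by (simp add: frac_le)
      then show "C (Suc n) \<subseteq> C n" by (auto simp: C_def)
    qed
  qed (use assms in \<open>auto simp: C_def intro: convex_Int bounded_Int\<close>)
  then obtain p where p: "\<And>n. p \<in> C n" by blast
  have "(\<lambda>n. infdist x S + 1 / real (Suc n)) \<longlonglongrightarrow> infdist x S + 0"
    by (intro tendsto_intros LIMSEQ_Suc[OF lim_1_over_n])
  then have "dist x p \<le> infdist x S + 0"
    using p by (intro LIMSEQ_le_const) (auto simp: C_def)
  moreover have "p \<in> S" using p[of 0] by (simp add: C_def)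
  ultimately show ?thesis
    using that infdist_le[of p S x] by (auto simp: dist_commute antisym)
qed

section \<open>Distance to the sublevel sets\<close>

text \<open>
  A convex combination of the projections onto two sublevel sets lies in the sublevel set of the
  combined level, and the norm is convex.
\<close>
lemma convex_on_infdist_sublevel:
  fixes f :: "'a::{real_inner, complete_space} \<Rightarrow> ereal"
  assumes "lower_semicontinuous f" "convex_fun f" "sublevel f c \<noteq> {}"
  shows "convex_on {c..} (\<lambda>s. infdist x (sublevel f s))"
proof (rule convex_onI)
  fix t a b :: real
  assume t: "0 < t" "t < 1" and ab: "a \<in> {c..}" "b \<in> {c..}"
  have ne: "sublevel f s \<noteq> {}" if "s \<in> {c..}" for s
    using that assms(3) sublevel_mono[of c s f] by auto
  obtain p where p: "p \<in> sublevel f a" "dist x p = infdist x (sublevel f a)"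
    using nearest_point_exists[OF closed_sublevel convex_sublevel ne] assms ab by metis
  obtain q where q: "q \<in> sublevel f b" "dist x q = infdist x (sublevel f b)"
    using nearest_point_exists[OF closed_sublevel convex_sublevel ne] assms ab by metis
  have "(1 - t) *\<^sub>R p + t *\<^sub>R q \<in> sublevel f ((1 - t) *\<^sub>R a + t *\<^sub>R b)"
    using convex_fun_combination_le[OF assms(2), of p a q b t] p q t by (simp add: sublevel_def)
  then have "infdist x (sublevel f ((1 - t) *\<^sub>R a + t *\<^sub>R b)) \<le> dist x ((1 - t) *\<^sub>R p + t *\<^sub>R q)"
    by (rule infdist_le)
  also have "\<dots> = norm ((1 - t) *\<^sub>R (x - p) + t *\<^sub>R (x - q))"
    by (simp add: dist_norm algebra_simps)
  also have "\<dots> \<le> (1 - t) * dist x p + t * dist x q"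
    using t by (intro norm_triangle_le) (simp add: dist_norm)
  finally show "infdist x (sublevel f ((1 - t) *\<^sub>R a + t *\<^sub>R b))
      \<le> (1 - t) * infdist x (sublevel f a) + t * infdist x (sublevel f b)"
    by (simp add: p q)
qed simp

text \<open>
  Away from \<open>x\<close> the norm is differentiable, so this is Fermat's rule for the convex function
  \<open>\<lambda>y. norm (x - y) + t * f y\<close>: the negative gradient of its first summand at \<open>p\<close> is a subgradient
  of the second. The proof compares \<open>p\<close> with nearby points on the segment to \<open>y\<close>.
\<close>
lemma subgradient_of_penalised_distance_minimiser:
  fixes f :: "'a::real_inner \<Rightarrow> ereal"
  assumes "proper_fun f" "convex_fun f" "0 < t" "p \<noteq> x" and fp: "f p = ereal a"
    and min: "\<And>y b. f y \<le> ereal b \<Longrightarrow> norm (x - p) + t * a \<le> norm (x - y) + t * b"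
  shows "(1 / (t * norm (x - p))) *\<^sub>R (x - p) \<in> subdifferential f p"
proof -
  define q where "q = x - p"
  have q: "0 < norm q" using assms by (simp add: q_def)
  have "f p + ereal ((1 / (t * norm q)) *\<^sub>R q \<bullet> (y - p)) \<le> f y" for y
  proof (cases "f y")
    case (real b)
    define w where "w = y - p"
    have step: "2 * (q \<bullet> w) \<le> 2 * norm q * (t * (b - a)) + \<theta> * (norm w)\<^sup>2"
      if \<theta>: "0 < \<theta>" "\<theta> < 1" for \<theta>
    proof -
      have "f ((1 - \<theta>) *\<^sub>R p + \<theta> *\<^sub>R y) \<le> ereal ((1 - \<theta>) * a + \<theta> * b)"
        using \<theta> real fp assms(2) by (intro convex_fun_combination_le) auto
      from min[OF this]
      have "norm q + t * a \<le> norm (q - \<theta> *\<^sub>R w) + t * ((1 - \<theta>) * a + \<theta> * b)"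
        by (simp add: q_def w_def algebra_simps)
      then have "norm q - \<theta> * (t * (b - a)) \<le> norm (q - \<theta> *\<^sub>R w)"
        by (simp add: algebra_simps)
      then have "2 * norm q * (norm q - \<theta> * (t * (b - a))) \<le> 2 * norm q * norm (q - \<theta> *\<^sub>R w)"
        using q by (intro mult_left_mono) auto
      \<comment> \<open>Passing to squares makes the norm a polynomial in \<open>\<theta>\<close>; the error is of second order.\<close>
      also have "\<dots> \<le> (norm q)\<^sup>2 + (norm (q - \<theta> *\<^sub>R w))\<^sup>2"
        by (rule sum_squares_bound)
      also have "(norm (q - \<theta> *\<^sub>R w))\<^sup>2 = (norm q)\<^sup>2 - 2 * \<theta> * (q \<bullet> w) + \<theta>\<^sup>2 * (norm w)\<^sup>2"
        unfolding power2_norm_eq_inner by (simp add: inner_commute power2_eq_square algebra_simps)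
      finally have "\<theta> * (2 * (q \<bullet> w)) \<le> \<theta> * (2 * norm q * (t * (b - a)) + \<theta> * (norm w)\<^sup>2)"
        by (simp add: algebra_simps power2_eq_square)
      then show ?thesis using \<theta> by simp
    qed
    have "q \<bullet> w \<le> norm q * (t * (b - a))"
    proof -
      have "((\<lambda>\<theta>. 2 * norm q * (t * (b - a)) + \<theta> * (norm w)\<^sup>2)
          \<longlongrightarrow> 2 * norm q * (t * (b - a)) + 0 * (norm w)\<^sup>2) (at_right 0)"
        by (intro tendsto_intros)
      moreover have "\<forall>\<^sub>F \<theta> in at_right 0. 2 * (q \<bullet> w) \<le> 2 * norm q * (t * (b - a)) + \<theta> * (norm w)\<^sup>2"
        using step by (auto simp: eventually_at_right[of 0 "1::real"] intro!: exI[of _ 1])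
      ultimately have "2 * (q \<bullet> w) \<le> 2 * norm q * (t * (b - a)) + 0 * (norm w)\<^sup>2"
        by (intro tendsto_lowerbound) auto
      then show ?thesis by simp
    qed
    then have "(1 / (t * norm q)) *\<^sub>R q \<bullet> w \<le> b - a"
      using q \<open>0 < t\<close> by (simp add: field_simps)
    then show ?thesis using real fp by (simp add: w_def)
  next
    case MInf
    then show ?thesis using assms(1) by (auto simp: proper_fun_def)
  qed auto
  then show ?thesis unfolding subdifferential_def q_def using fp by simp
qed

text \<open>
  Here \<open>t\<close> is minus the slope of a supporting line at \<open>s\<close> of the convex function \<open>D\<close> that maps a
  level to the distance from \<open>x\<close> to its sublevel set. Any \<open>y\<close> of value \<open>b\<close> satisfies
  \<open>norm (x - y) \<ge> D b\<close>, so the supporting line turns the constrained projection problem at level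
  \<open>s\<close> into an unconstrained penalised one with multiplier \<open>t\<close>. The supporting line exists because \<open>s\<close>
  lies strictly above the minimum \<open>c\<close>, inside the domain of \<open>D\<close>; this is Slater's condition.
\<close>
lemma sublevel_distance_slope:
  fixes f :: "'a::{real_inner, complete_space} \<Rightarrow> ereal"
  assumes "proper_fun f" "lower_semicontinuous f" "convex_fun f"
    and fz: "f z = ereal c" and minz: "\<And>y. f z \<le> f y"
    and "c < s" and fx: "ereal s < f x"
  obtains t where "0 \<le> t"
    "\<And>s'. c \<le> s' \<Longrightarrow> infdist x (sublevel f s) \<le> infdist x (sublevel f s') + t * (s' - s)"
    "0 < t \<Longrightarrow> \<exists>p v. f p = ereal s \<and> dist z p \<le> dist z x \<and> v \<in> subdifferential f p \<and> t * norm v = 1"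
proof -
  define D where "D s' = infdist x (sublevel f s')" for s'
  have zc: "z \<in> sublevel f c" by (simp add: sublevel_def fz)
  then have zs: "z \<in> sublevel f s" using sublevel_mono[of c s f] \<open>c < s\<close> by auto
  have conv: "convex_on {c..} D"
    unfolding D_def using assms zc by (intro convex_on_infdist_sublevel) auto
  have "s \<in> interior {c..}" using \<open>c < s\<close> by (simp add: interior_Ici[of "c - 1"])
  then obtain k where k: "\<And>s'. c \<le> s' \<Longrightarrow> D s + k * (s' - s) \<le> D s'"
    using convex_le_Inf_differential[OF conv] by fastforce
  have k0: "k \<le> 0"
  proof -
    have "D (s + 1) \<le> D s"
      unfolding D_def using zs by (intro infdist_mono sublevel_mono) auto
    then show ?thesis using k[of "s + 1"] \<open>c < s\<close> by simp
  qed
  obtain p where p: "p \<in> sublevel f s" "dist x p = D s"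
    using nearest_point_exists[OF closed_sublevel convex_sublevel] zs assms unfolding D_def
    by (metis empty_iff)
  have "p \<noteq> x" using p fx by (auto simp: sublevel_def)
  show ?thesis
  proof (rule that[of "- k"])
    assume t: "0 < - k"
    obtain a where a: "f p = ereal a" "a \<le> s"
      using p assms(1) by (cases "f p") (auto simp: sublevel_def proper_fun_def)
    have ca: "c \<le> a" using minz[of p] a fz by simp
    have "D a \<le> dist x p"
      unfolding D_def using a by (intro infdist_le) (simp add: sublevel_def)
    then have "k * (a - s) \<le> 0" using k[OF ca] p by simp
    \<comment> \<open>If \<open>f p\<close> were below \<open>s\<close>, then \<open>D\<close> would be flat between them, against its negative slope.\<close>
    then have as: "a = s" using a t by (auto simp: mult_le_0_iff)
    have min: "norm (x - p) + (- k) * s \<le> norm (x - y) + (- k) * b" if "f y \<le> ereal b" for y b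
    proof -
      have "c \<le> b" using minz[of y] that fz by (metis ereal_less_eq(3) order_trans)
      moreover have "D b \<le> dist x y"
        unfolding D_def using that by (intro infdist_le) (simp add: sublevel_def)
      ultimately show ?thesis using k[of b] p by (simp add: dist_norm algebra_simps)
    qed
    define v where "v = (1 / ((- k) * norm (x - p))) *\<^sub>R (x - p)"
    have v: "v \<in> subdifferential f p"
      unfolding v_def using assms t \<open>p \<noteq> x\<close> a as min
      by (intro subgradient_of_penalised_distance_minimiser) auto
    \<comment> \<open>The subgradient \<open>v\<close> points along \<open>x - p\<close> and makes an obtuse angle with \<open>z - p\<close>.\<close>
    have "(x - p) \<bullet> (z - p) \<le> 0"
    proof -
      have "f p + ereal (v \<bullet> (z - p)) \<le> f z" using v by (simp add: subdifferential_def)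
      then have "v \<bullet> (z - p) \<le> 0" using a ca fz by simp
      moreover have "(x - p) \<bullet> (z - p) = ((- k) * norm (x - p)) * (v \<bullet> (z - p))"
        using t \<open>p \<noteq> x\<close> by (simp add: v_def)
      ultimately show ?thesis
        using t by (metis less_eq_real_def mult_nonneg_nonneg mult_nonneg_nonpos norm_ge_zero)
    qed
    moreover have "(norm (z - x))\<^sup>2 = (norm (z - p))\<^sup>2 - 2 * ((x - p) \<bullet> (z - p)) + (norm (x - p))\<^sup>2"
      by (simp add: power2_norm_eq_inner inner_commute algebra_simps)
    ultimately have "(norm (z - p))\<^sup>2 \<le> (norm (z - x))\<^sup>2"
      using zero_le_power2[of "norm (x - p)"] by linarith
    then have "dist z p \<le> dist z x"
      unfolding dist_norm by (rule power2_le_imp_le) simp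
    moreover have "- k * norm v = 1" using t \<open>p \<noteq> x\<close> by (simp add: v_def abs_mult)
    ultimately show "\<exists>p v. f p = ereal s \<and> dist z p \<le> dist z x \<and> v \<in> subdifferential f p \<and> - k * norm v = 1"
      using a as v by blast
  qed (use k k0 in \<open>auto simp: D_def algebra_simps\<close>)
qed

lemma argmin_within_limit_distance:
  fixes f :: "'a::{real_inner, complete_space} \<Rightarrow> ereal"
  assumes "lower_semicontinuous f" "convex_fun f"
    and fz: "f z = ereal c" and minz: "\<And>y. f z \<le> f y"
    and "decseq s" "s \<longlonglongrightarrow> c" and bound: "\<And>n. infdist x (sublevel f (s n)) \<le> R"
  obtains p where "p \<in> argmin_set f" "dist x p \<le> R"
proof -
  define C where "C n = sublevel f (s n) \<inter> cball x R" for n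
  have z: "z \<in> sublevel f (s n)" for n
    using decseq_ge[OF assms(5,6), of n] fz by (simp add: sublevel_def)
  have "(\<Inter>n. C n) \<noteq> {}"
  proof (rule Inter_decreasing_closed_convex_nonempty)
    fix n
    obtain p where "p \<in> sublevel f (s n)" "dist x p = infdist x (sublevel f (s n))"
      using nearest_point_exists[OF closed_sublevel convex_sublevel] z assms by (metis empty_iff)
    then show "C n \<noteq> {}" using bound[of n] by (auto simp: C_def)
  next
    show "decseq C"
      unfolding C_def decseq_def using decseqD[OF assms(5)] by (intro allI impI Int_mono sublevel_mono) auto
  qed (use assms in \<open>auto simp: C_def intro: convex_Int bounded_Int convex_sublevel closed_sublevel\<close>)
  then obtain p where p: "\<And>n. p \<in> C n" by blast
  have lim: "(\<lambda>n. ereal (s n)) \<longlonglongrightarrow> ereal c" using assms(6) by simp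
  have "f p \<le> ereal (s n)" for n using p[of n] by (simp add: C_def sublevel_def)
  then have "f p \<le> f z"
    unfolding fz using LIMSEQ_le_const[OF lim] by blast
  then have "p \<in> argmin_set f"
    using minz by (auto simp: argmin_set_def is_arg_min_def not_less intro: order_trans)
  moreover have "dist x p \<le> R" using p[of 0] by (simp add: C_def)
  ultimately show ?thesis using that by blast
qed

section \<open>Desingularizing functions\<close>

text \<open>
  The tangent point \<open>b\<close> is interior, but \<open>a\<close> may be the endpoint 0, at which \<open>\<phi>\<close> is only continuous.
\<close>
lemma desingularizing_tangent:
  assumes "\<phi> \<in> desingularizing \<eta>" "0 < b" "ereal b < \<eta>" "0 \<le> a" "ereal a < \<eta>"
  shows "\<phi> a \<le> \<phi> b + deriv \<phi> b * (a - b)"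
proof -
  let ?I = "{s. 0 \<le> s \<and> ereal s < \<eta>}"
  have diff: "\<phi> C1_differentiable_on {s. 0 < s \<and> ereal s < \<eta>}" and conc: "concave_on ?I \<phi>"
    using assms(1) by (auto simp: desingularizing_def)
  have "\<phi> differentiable at b"
    using diff assms by (auto simp: C1_differentiable_on_eq)
  then have D: "(\<phi> has_real_derivative deriv \<phi> b) (at b)"
    by (simp add: DERIV_deriv_iff_real_differentiable)
  have op: "open {s. 0 < s \<and> ereal s < \<eta>}"
    by (intro open_Collect_conj open_Collect_less continuous_intros)
  have "- \<phi> a - (- \<phi> b) \<ge> (- deriv \<phi> b) * (a - b)"
  proof (rule convex_on_imp_above_tangent[where A = ?I])
    show "convex_on ?I (\<lambda>s. - \<phi> s)" using conc by (simp add: concave_on_def)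
    then show "connected ?I" by (auto dest: convex_on_imp_convex intro: convex_connected)
    show "b \<in> interior ?I" using op assms by (intro interiorI[OF op]) auto
    show "((\<lambda>s. - \<phi> s) has_real_derivative - deriv \<phi> b) (at b within ?I)"
      by (rule DERIV_minus[OF has_field_derivative_at_within[OF D]])
  qed (use assms in auto)
  then show ?thesis by simp
qed

lemma desingularizing_mono:
  assumes "\<phi> \<in> desingularizing \<eta>" "0 \<le> a" "a \<le> b" "ereal b < \<eta>"
  shows "\<phi> a \<le> \<phi> b"
proof (cases "b = 0")
  case False
  have a: "ereal a < \<eta>" using assms by (meson ereal_less_eq(3) le_less_trans)
  have "0 < deriv \<phi> b" using assms False by (auto simp: desingularizing_def)
  then have "deriv \<phi> b * (a - b) \<le> 0" using assms by (simp add: mult_le_0_iff)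
  with desingularizing_tangent[OF assms(1) _ assms(4) assms(2) a] False assms show ?thesis
    by simp
qed (use assms in auto)

section \<open>The error bound\<close>

text \<open>
  A lower bound \<open>1 / d\<close> for the norms of subgradients at level \<open>s\<close>, imposed no farther from the
  minimiser \<open>z\<close> than \<open>x\<close> is, bounds the multiplier \<open>t\<close> by \<open>d\<close>. In the error bound \<open>d\<close> is the value of
  the derivative of \<open>\<phi>\<close>.
\<close>
lemma sublevel_distance_step:
  fixes f :: "'a::{real_inner, complete_space} \<Rightarrow> ereal"
  assumes "proper_fun f" "lower_semicontinuous f" "convex_fun f"
    and fz: "f z = ereal c" and minz: "\<And>y. f z \<le> f y"
    and "c < s" and fx: "ereal s < f x" and "s \<le> s'" and "0 < d"
    and KL: "\<And>p. dist z p \<le> dist z x \<Longrightarrow> f p = ereal s \<Longrightarrow>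
      1 \<le> ereal d * set_distance 0 (subdifferential f p)"
  shows "infdist x (sublevel f s) \<le> infdist x (sublevel f s') + d * (s' - s)"
proof -
  obtain t where t: "0 \<le> t"
    "\<And>u. c \<le> u \<Longrightarrow> infdist x (sublevel f s) \<le> infdist x (sublevel f u) + t * (u - s)"
    "0 < t \<Longrightarrow> \<exists>p v. f p = ereal s \<and> dist z p \<le> dist z x \<and> v \<in> subdifferential f p \<and> t * norm v = 1"
    using sublevel_distance_slope[OF assms(1-3) fz minz \<open>c < s\<close> fx] by blast
  have "t \<le> d"
  proof (cases "t = 0")
    case False
    then obtain p v where p: "f p = ereal s" "dist z p \<le> dist z x"
      and v: "v \<in> subdifferential f p" "t * norm v = 1"
      using t(1,3) by (metis less_eq_real_def)
    have "1 \<le> ereal d * set_distance 0 (subdifferential f p)" by (rule KL[OF p(2,1)])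
    also have "\<dots> \<le> ereal d * ereal (norm v)"
    proof (rule ereal_mult_left_mono)
      show "set_distance 0 (subdifferential f p) \<le> ereal (norm v)"
        unfolding set_distance_def using INF_lower[OF v(1), of "\<lambda>u. ereal (norm (0 - u))"] by simp
    qed (use \<open>0 < d\<close> in auto)
    finally have "1 \<le> d * norm v" by (simp add: one_ereal_def)
    then have "t * norm v \<le> d * norm v" using v(2) by simp
    moreover have "0 < norm v" using v(2) by auto
    ultimately show ?thesis by simp
  qed (use \<open>0 < d\<close> in simp)
  then have "t * (s' - s) \<le> d * (s' - s)"
    using assms by (intro mult_right_mono) auto
  then show ?thesis using t(2)[of s'] \<open>c < s\<close> \<open>s \<le> s'\<close> by linarith
qed

theorem theorem2p1:
  fixes f :: "'a::{real_inner, complete_space} \<Rightarrow> ereal"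
    and xbar :: 'a and r :: real and \<eta> :: ereal and \<phi> :: "real \<Rightarrow> real"
  assumes "proper_fun f"
    and "lower_semicontinuous f"
    and "convex_fun f"
    and "xbar \<in> argmin_set f"
    and "r > 0"
    and "\<eta> > 0"
    and "\<phi> \<in> desingularizing \<eta>"
    and "\<And>x. x \<in> ball xbar r \<Longrightarrow> f xbar < f x \<Longrightarrow> f x < f xbar + \<eta> \<Longrightarrow>
           ereal (deriv \<phi> (real_of_ereal (f x - f xbar)))
             * set_distance 0 (subdifferential f x) \<ge> 1"
  shows "\<forall>x \<in> ball xbar r. f xbar \<le> f x \<and> f x < f xbar + \<eta> \<longrightarrow>
           set_distance x (argmin_set f) \<le> ereal (2 * \<phi> (real_of_ereal (f x - f xbar)))"
proof (intro ballI impI)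
  fix x assume x: "x \<in> ball xbar r" and "f xbar \<le> f x \<and> f x < f xbar + \<eta>"
  then have fx\<eta>: "f x < f xbar + \<eta>" by simp
  have minz: "f xbar \<le> f y" for y
    using assms(4) by (auto simp: argmin_set_def is_arg_min_def not_less)
  obtain c where c: "f xbar = ereal c"
  proof -
    obtain u where "f u \<noteq> \<infinity>" using assms(1) by (auto simp: proper_fun_def)
    then have "f xbar \<noteq> \<infinity>" using minz[of u] by auto
    then show ?thesis using that assms(1) by (cases "f xbar") (auto simp: proper_fun_def)
  qed
  obtain h where h: "f x = ereal (c + h)"
  proof -
    obtain a where "f x = ereal a"
      using fx\<eta> minz[of x] c by (cases "f x") auto
    then show ?thesis using that[of "a - c"] by simp
  qed
  have h0: "0 \<le> h" using minz[of x] c h by simp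
  have h\<eta>: "ereal h < \<eta>" using fx\<eta> c h by (cases \<eta>) auto
  \<comment> \<open>Each step down is twice the next one, which lets concavity be used at its lower end.\<close>
  define b where "b n = h / 2 ^ n" for n :: nat
  have b_Suc: "b (Suc n) = b n / 2" for n by (simp add: b_def)
  have b_bnd: "0 \<le> b n" "b n \<le> h" for n
    using h0 by (auto simp: b_def divide_le_eq mult_le_cancel_left1)
  have b\<eta>: "ereal (b n) < \<eta>" for n
    using b_bnd(2)[of n] h\<eta> by (meson ereal_less_eq(3) le_less_trans)
  have \<phi>0: "\<phi> 0 = 0" and \<phi>pos: "\<And>s. 0 < s \<Longrightarrow> ereal s < \<eta> \<Longrightarrow> 0 < deriv \<phi> s"
    using assms(7) by (auto simp: desingularizing_def)
  define D where "D n = infdist x (sublevel f (c + b n))" for n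
  have step: "D (Suc n) \<le> D n + 2 * (\<phi> (b (Suc n)) - \<phi> (b (Suc (Suc n))))" if hpos: "0 < h" for n
  proof -
    have bpos: "0 < b k" for k using hpos by (simp add: b_def)
    have "b (Suc n) < h" using b_bnd(2)[of n] bpos[of n] b_Suc[of n] by linarith
    then have "D (Suc n) \<le> D n + deriv \<phi> (b (Suc n)) * (c + b n - (c + b (Suc n)))"
      unfolding D_def
    proof (intro sublevel_distance_step[OF assms(1-3) c minz])
      fix p assume p: "dist xbar p \<le> dist xbar x" "f p = ereal (c + b (Suc n))"
      have "p \<in> ball xbar r" using p(1) x by simp
      moreover have "f xbar < f p" using p c bpos by simp
      moreover have "f p < f xbar + \<eta>" using p c b\<eta>[of "Suc n"] by (cases \<eta>) auto
      ultimately show "1 \<le> ereal (deriv \<phi> (b (Suc n))) * set_distance 0 (subdifferential f p)"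
        using assms(8)[of p] p c by simp
    qed (use bpos b\<eta> h \<phi>pos b_Suc[of n] b_bnd[of n] in auto)
    moreover have "\<phi> (b (Suc (Suc n))) \<le> \<phi> (b (Suc n)) + deriv \<phi> (b (Suc n)) * (b (Suc (Suc n)) - b (Suc n))"
      using bpos b\<eta> b_bnd by (intro desingularizing_tangent[OF assms(7)]) auto
    moreover have "b n - b (Suc n) = - 2 * (b (Suc (Suc n)) - b (Suc n))"
      by (simp add: b_Suc)
    ultimately show ?thesis by (simp add: algebra_simps)
  qed
  have D0: "D 0 = 0" by (simp add: D_def b_def sublevel_def h)
  \<comment> \<open>The right-hand side is one index ahead of the left: the step to \<open>b (Suc n)\<close> is paid for by the
    increment of \<open>\<phi>\<close> over the following step.\<close>
  have tele: "D n \<le> 2 * (\<phi> (b 0) - \<phi> (b (Suc n)))" for n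
  proof (cases "h = 0")
    case True
    then show ?thesis using D0 by (simp add: D_def b_def)
  next
    case False
    show ?thesis
    proof (induction n)
      case 0
      have "\<phi> (b 1) \<le> \<phi> (b 0)"
        using h0 h\<eta> b_bnd b\<eta> b_Suc[of 0] by (intro desingularizing_mono[OF assms(7)]) (auto simp: b_def)
      then show ?case using D0 by simp
    next
      case (Suc n)
      then show ?case using step[of n] False h0 by simp
    qed
  qed
  have "D n \<le> 2 * \<phi> h" for n
  proof -
    have "0 \<le> \<phi> (b (Suc n))"
      using desingularizing_mono[OF assms(7) order_refl b_bnd(1) b\<eta>] \<phi>0 by simp
    moreover have "b 0 = h" by (simp add: b_def)
    ultimately show ?thesis using tele[of n] by simp
  qed
  moreover have "decseq (\<lambda>n. c + b n)"
    by (intro decseq_SucI) (use b_bnd(1) in \<open>simp add: b_Suc\<close>)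
  moreover have "(\<lambda>n. c + b n) \<longlonglongrightarrow> c"
  proof -
    have "(\<lambda>n. c + h * (1 / 2) ^ n) \<longlonglongrightarrow> c + h * 0"
      by (intro tendsto_intros LIMSEQ_power_zero) auto
    then show ?thesis by (simp add: b_def power_one_over field_simps)
  qed
  ultimately obtain p where p: "p \<in> argmin_set f" "dist x p \<le> 2 * \<phi> h"
    using argmin_within_limit_distance[OF assms(2,3) c minz, of "\<lambda>n. c + b n" x "2 * \<phi> h"]
    unfolding D_def by metis
  have "set_distance x (argmin_set f) \<le> ereal (norm (x - p))"
    unfolding set_distance_def by (rule INF_lower[OF p(1)])
  also have "\<dots> \<le> ereal (2 * \<phi> h)" using p(2) by (simp add: dist_norm)
  finally show "set_distance x (argmin_set f) \<le> ereal (2 * \<phi> (real_of_ereal (f x - f xbar)))"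
    by (simp add: h c)
qed

end
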